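(* Let $R$ be an associative ring with unity, let $n\in\mathbb{N}$, let $a\in R$ be $pns$-Drazin invertible (for this $n$), and let $b\in R$. For a $pns$-Drazin invertible element $c$ write $c^{(D)}$ for its $pns$-Drazin inverse and $c^{\Pi}=cc^{(D)}$. The following are equivalent: (1) $b$ is $pns$-Drazin invertible and $a^{\Pi}=b^{\Pi}$. (2) $a^{\Pi}\in\mathrm{comm}^2(b)$ and $b^n-a^{\Pi}\in\sqrt{J(R)}$. (3) $a^{\Pi}\in\mathrm{comm}^2(b)$, $b(1-a^{\Pi})\in\sqrt{J(R)}$ and $(1-b^n)a^{\Pi}\in\sqrt{J(R)}$. (4) $b$ is $pns$-Drazin invertible, $1-a^{\Pi}(1-a^{(D)}b)\in U(R)$ and $b^{(D)}=\bigl(1-a^{\Pi}(1-a^{(D)}b)\bigr)^{-1}a^{(D)}$. (5) $b$ is $pns$-Drazin invertible and $b^{(D)}-a^{(D)}=a^{(D)}(a-b)b^{(D)}$. (6) $b$ is $pns$-Drazin invertible, $a^{\Pi}b^{\Pi}=b^{\Pi}a^{\Pi}$ and $1-(a^{\Pi}-b^{\Pi})^2\in U(R)$. (7) $b$ is $pns$-Drazin invertible, $b^{(D)}R\subseteq a^{(D)}R$ and $r(b^{(D)})\subseteq r(a^{(D)})$.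
   Context: $\mathbb{N}$ is the set of positive integers. For a ring $R$: $U(R)$ is the set of invertible elements, $J(R)$ is the Jacobson radical, and $\sqrt{J(R)}=\{x\in R: x^k\in J(R)\text{ for some }k\ge 1\}$. For $x\in R$: $\mathrm{comm}(x)=\{y\in R: xy=yx\}$, $\mathrm{comm}^2(x)=\{y\in R: yz=zy\text{ for all }z\in\mathrm{comm}(x)\}$, and $r(x)=\{y\in R: xy=0\}$ is the right annihilator. For a fixed $n\in\mathbb{N}$, an element $a\in R$ is pseudo $n$-strong Drazin invertible ($pns$-Drazin invertible) if there exists $x\in R$ with $xax=x$, $x\in\mathrm{comm}^2(a)$ and $a^n-ax\in\sqrt{J(R)}$. Such an $x$ is unique when it exists (known), is called the $pns$-Drazin inverse of $a$, and is denoted here by $a^{(D)}$. The same $n$ is used for all elements. *)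

theory Defs
  imports "HOL-Algebra.Algebra"
begin

text \<open>
  HOL-Algebra's locale \<^locale>\<open>ring\<close> is the class of associative unital, not necessarily
  commutative rings, and \<^locale>\<open>ideal\<close> means two-sided ideal. The Jacobson radical of such a
  ring needs one-sided ideals, which are introduced here.
\<close>

definition left_ideal :: "'a set \<Rightarrow> ('a, 'b) ring_scheme \<Rightarrow> bool" where
  "left_ideal I R \<longleftrightarrow>
     additive_subgroup I R \<and> (\<forall>r\<in>carrier R. \<forall>x\<in>I. r \<otimes>\<^bsub>R\<^esub> x \<in> I)"

definition maximal_left_ideal :: "'a set \<Rightarrow> ('a, 'b) ring_scheme \<Rightarrow> bool" where
  "maximal_left_ideal M R \<longleftrightarrow>
     left_ideal M R \<and> M \<noteq> carrier R \<and>
     (\<forall>I. left_ideal I R \<and> M \<subseteq> I \<longrightarrow> I = M \<or> I = carrier R)"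

text \<open>
  The explicit intersection with the carrier only matters for the zero ring, which has no maximal
  left ideal and equals its own radical.
\<close>

definition jacobson_radical :: "('a, 'b) ring_scheme \<Rightarrow> 'a set" where
  "jacobson_radical R = carrier R \<inter> \<Inter> {M. maximal_left_ideal M R}"

definition sqrt_jacobson :: "('a, 'b) ring_scheme \<Rightarrow> 'a set" where
  "sqrt_jacobson R =
     {x \<in> carrier R. \<exists>k::nat. k \<ge> 1 \<and> x [^]\<^bsub>R\<^esub> k \<in> jacobson_radical R}"

definition comm :: "('a, 'b) ring_scheme \<Rightarrow> 'a \<Rightarrow> 'a set" where
  "comm R x = {y \<in> carrier R. x \<otimes>\<^bsub>R\<^esub> y = y \<otimes>\<^bsub>R\<^esub> x}"

definition comm2 :: "('a, 'b) ring_scheme \<Rightarrow> 'a \<Rightarrow> 'a set" where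
  "comm2 R x = {y \<in> carrier R. \<forall>z \<in> comm R x. y \<otimes>\<^bsub>R\<^esub> z = z \<otimes>\<^bsub>R\<^esub> y}"

definition right_annihilator :: "('a, 'b) ring_scheme \<Rightarrow> 'a \<Rightarrow> 'a set" where
  "right_annihilator R x = {y \<in> carrier R. x \<otimes>\<^bsub>R\<^esub> y = \<zero>\<^bsub>R\<^esub>}"

definition is_pns_drazin_inverse ::
    "('a, 'b) ring_scheme \<Rightarrow> nat \<Rightarrow> 'a \<Rightarrow> 'a \<Rightarrow> bool" where
  "is_pns_drazin_inverse R n a x \<longleftrightarrow>
     x \<in> carrier R \<and>
     x \<otimes>\<^bsub>R\<^esub> a \<otimes>\<^bsub>R\<^esub> x = x \<and>
     x \<in> comm2 R a \<and>
     a [^]\<^bsub>R\<^esub> n \<ominus>\<^bsub>R\<^esub> a \<otimes>\<^bsub>R\<^esub> x \<in> sqrt_jacobson R"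

definition pns_drazin_invertible :: "('a, 'b) ring_scheme \<Rightarrow> nat \<Rightarrow> 'a \<Rightarrow> bool" where
  "pns_drazin_invertible R n a \<longleftrightarrow> (\<exists>x. is_pns_drazin_inverse R n a x)"

text \<open>
  The two functions below are only meaningful for \<^const>\<open>pns_drazin_invertible\<close> arguments,
  for which the inverse is unique.
\<close>

definition pns_drazin_inverse :: "('a, 'b) ring_scheme \<Rightarrow> nat \<Rightarrow> 'a \<Rightarrow> 'a" where
  "pns_drazin_inverse R n a = (THE x. is_pns_drazin_inverse R n a x)"

definition pns_idempotent :: "('a, 'b) ring_scheme \<Rightarrow> nat \<Rightarrow> 'a \<Rightarrow> 'a" where
  "pns_idempotent R n a = a \<otimes>\<^bsub>R\<^esub> pns_drazin_inverse R n a"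

end

theory Submission
  imports Defs
begin

text \<open>
  The inverse is determined by its idempotent p = by. Given p in the bicommutant of b with
  w = b^n - p in the square root of J, the element u = 1 + w is a unit of the bicommutant and
  up = b^n p, so b^(n-1) u^(-1) p is the inverse of b with idempotent p. This gives (1) iff (2);
  the Peirce decomposition of w with respect to p gives (3).

  The remaining conditions do not involve J: they concern only elements x and y with
  xa = ax, xax = x, yb = by, yby = y. Conditions (4), (5) and (7) each yield the two absorption
  laws x(by) = x and (ax)y = y, which force ax = by.
\<close>

section \<open>Left ideals and the existence of maximal ones\<close>

lemma left_ideal_mult_closed:
  "left_ideal I R \<Longrightarrow> r \<in> carrier R \<Longrightarrow> x \<in> I \<Longrightarrow> r \<otimes>\<^bsub>R\<^esub> x \<in> I"
  by (auto simp: left_ideal_def)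

lemma left_ideal_subset: "left_ideal I R \<Longrightarrow> I \<subseteq> carrier R"
  by (simp add: left_ideal_def additive_subgroup.a_subset)

context ring
begin

text \<open>Negation is multiplication by \<open>\<ominus> \<one>\<close>, so closure under additive
  inverses follows from closure under left multiplication. The criterion is easy to check for
  unions, intersections and principal left ideals.\<close>

lemma left_ideal_iff:
  "left_ideal I R \<longleftrightarrow> I \<subseteq> carrier R \<and> \<zero> \<in> I \<and> (\<forall>x\<in>I. \<forall>y\<in>I. x \<oplus> y \<in> I) \<and>
     (\<forall>r\<in>carrier R. \<forall>x\<in>I. r \<otimes> x \<in> I)" (is "_ \<longleftrightarrow> ?rhs")
proof
  assume "left_ideal I R"
  then show ?rhs
    unfolding left_ideal_def
    by (metis additive_subgroup.a_closed additive_subgroup.a_subset additive_subgroup.zero_closed)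
next
  assume I: ?rhs
  have "\<ominus> x \<in> I" if "x \<in> I" for x
  proof -
    have "\<ominus> x = (\<ominus> \<one>) \<otimes> x"
      using I that l_minus[of \<one> x] by auto
    then show ?thesis
      using I that by auto
  qed
  then have "subgroup I (add_monoid R)"
    using I by (intro add.subgroupI) (auto simp: a_inv_def)
  then show "left_ideal I R"
    using I by (auto simp: left_ideal_def additive_subgroup_def)
qed

lemma left_ideal_eq_carrier: "left_ideal I R \<Longrightarrow> \<one> \<in> I \<Longrightarrow> I = carrier R"
  using left_ideal_mult_closed[of I R _ \<one>] left_ideal_subset[of I R] by auto

text \<open>Two elements of the union already lie in the larger of two comparable members, where
  they can be added; nonemptiness of \<open>C\<close> supplies zero.\<close>

lemma left_ideal_Union_chain:
  assumes "C \<noteq> {}" and "\<And>I. I \<in> C \<Longrightarrow> left_ideal I R"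
    and "\<And>I K. I \<in> C \<Longrightarrow> K \<in> C \<Longrightarrow> I \<subseteq> K \<or> K \<subseteq> I"
  shows "left_ideal (\<Union>C) R"
  unfolding left_ideal_iff
proof (intro conjI ballI)
  fix x y assume "x \<in> \<Union>C" "y \<in> \<Union>C"
  then obtain I K where "I \<in> C" "K \<in> C" "x \<in> I" "y \<in> K" by auto
  then show "x \<oplus> y \<in> \<Union>C"
    using assms(2,3)[unfolded left_ideal_iff] by (metis UnionI subsetD)
qed (use assms(1,2)[unfolded left_ideal_iff] in blast)+

text \<open>Zorn's lemma is applied to the left ideals that contain \<open>I\<close> and omit
  \<open>\<one>\<close>. A maximal one among them is a maximal left ideal, because a left ideal
  containing \<open>\<one>\<close> is the whole ring.\<close>

lemma left_ideal_subset_maximal: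
  assumes "left_ideal I R" and "\<one> \<notin> I"
  obtains M where "maximal_left_ideal M R" and "I \<subseteq> M"
proof -
  let ?A = "{K. left_ideal K R \<and> I \<subseteq> K \<and> \<one> \<notin> K}"
  have "\<exists>M\<in>?A. \<forall>K\<in>?A. M \<subseteq> K \<longrightarrow> K = M"
  proof (rule subset_Zorn_nonempty)
    show "?A \<noteq> {}" using assms by auto
  next
    fix C assume C: "C \<noteq> {}" "subset.chain ?A C"
    then have "left_ideal (\<Union>C) R"
      by (intro left_ideal_Union_chain) (auto simp: subset_chain_def)
    with C show "\<Union>C \<in> ?A"
      by (auto simp: subset_chain_def)
  qed
  then obtain M where M: "left_ideal M R" "I \<subseteq> M" "\<one> \<notin> M"
    and max: "\<And>K. left_ideal K R \<Longrightarrow> I \<subseteq> K \<Longrightarrow> \<one> \<notin> K \<Longrightarrow> M \<subseteq> K \<Longrightarrow> K = M"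
    by auto
  have "maximal_left_ideal M R"
    unfolding maximal_left_ideal_def
    using M max left_ideal_eq_carrier one_closed by (metis subset_trans)
  with M that show ?thesis by blast
qed

lemma left_ideal_principal:
  assumes "x \<in> carrier R"
  shows "left_ideal ((\<lambda>r. r \<otimes> x) ` carrier R) R"
  unfolding left_ideal_iff
proof (intro conjI ballI)
  show "\<zero> \<in> (\<lambda>r. r \<otimes> x) ` carrier R"
    using assms by (intro image_eqI[of _ _ \<zero>]) auto
next
  fix y z assume "y \<in> (\<lambda>r. r \<otimes> x) ` carrier R" "z \<in> (\<lambda>r. r \<otimes> x) ` carrier R"
  then obtain r s where "r \<in> carrier R" "s \<in> carrier R" "y = r \<otimes> x" "z = s \<otimes> x" by auto
  then show "y \<oplus> z \<in> (\<lambda>r. r \<otimes> x) ` carrier R"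
    using assms by (intro image_eqI[of _ _ "r \<oplus> s"]) (auto simp: l_distr)
next
  fix r y assume "r \<in> carrier R" "y \<in> (\<lambda>r. r \<otimes> x) ` carrier R"
  then obtain s where "r \<in> carrier R" "s \<in> carrier R" "y = s \<otimes> x" by auto
  then show "r \<otimes> y \<in> (\<lambda>r. r \<otimes> x) ` carrier R"
    using assms by (intro image_eqI[of _ _ "r \<otimes> s"]) (auto simp: m_assoc)
qed (use assms in auto)

section \<open>The Jacobson radical and the units \<open>\<one> \<oplus> j\<close>\<close>

lemma left_ideal_jacobson_radical: "left_ideal (jacobson_radical R) R"
proof -
  have "left_ideal M R" if "maximal_left_ideal M R" for M
    using that by (simp add: maximal_left_ideal_def)
  then show ?thesis
    unfolding left_ideal_iff jacobson_radical_def by auto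
qed

lemma jacobson_radical_closed: "j \<in> jacobson_radical R \<Longrightarrow> j \<in> carrier R"
  by (simp add: jacobson_radical_def)

lemma jacobson_radical_mult:
  "r \<in> carrier R \<Longrightarrow> j \<in> jacobson_radical R \<Longrightarrow> r \<otimes> j \<in> jacobson_radical R"
  by (rule left_ideal_mult_closed[OF left_ideal_jacobson_radical])

lemma jacobson_radical_add:
  "i \<in> jacobson_radical R \<Longrightarrow> j \<in> jacobson_radical R \<Longrightarrow> i \<oplus> j \<in> jacobson_radical R"
  using left_ideal_jacobson_radical by (simp add: left_ideal_iff)

lemma jacobson_radical_uminus:
  assumes "j \<in> jacobson_radical R" shows "\<ominus> j \<in> jacobson_radical R"
proof -
  have "\<ominus> j = (\<ominus> \<one>) \<otimes> j"
    using jacobson_radical_closed[OF assms] l_minus[of \<one> j] by auto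
  then show ?thesis
    using jacobson_radical_mult[of "\<ominus> \<one>" j] assms by simp
qed

text \<open>If \<open>\<one>\<close> were missing from the principal left ideal of
  \<open>\<one> \<oplus> j\<close>, some maximal left ideal would contain both
  \<open>\<one> \<oplus> j\<close> and \<open>j\<close>, hence also \<open>\<one>\<close>.\<close>

lemma one_plus_jacobson_left_inverse:
  assumes "j \<in> jacobson_radical R"
  obtains v where "v \<in> carrier R" and "v \<otimes> (\<one> \<oplus> j) = \<one>"
proof -
  note j = jacobson_radical_closed[OF assms]
  let ?I = "(\<lambda>r. r \<otimes> (\<one> \<oplus> j)) ` carrier R"
  have I: "left_ideal ?I R" using j by (intro left_ideal_principal) auto
  have "\<one> \<in> ?I"
  proof (rule ccontr)
    assume "\<one> \<notin> ?I"
    with I obtain M where M: "maximal_left_ideal M R" "?I \<subseteq> M"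
      by (rule left_ideal_subset_maximal)
    then have M_left: "left_ideal M R" by (simp add: maximal_left_ideal_def)
    have "\<one> \<otimes> (\<one> \<oplus> j) \<in> M" using M(2) by blast
    then have "\<one> \<oplus> j \<in> M" using j by simp
    moreover have "\<ominus> j \<in> M"
      using jacobson_radical_uminus[OF assms] M(1) by (simp add: jacobson_radical_def)
    ultimately have "(\<one> \<oplus> j) \<oplus> \<ominus> j \<in> M"
      using M_left by (simp add: left_ideal_iff)
    then have "\<one> \<in> M" using j by (simp add: a_assoc r_neg)
    then show False
      using left_ideal_eq_carrier[OF M_left] M(1) by (simp add: maximal_left_ideal_def)
  qed
  then obtain v where "v \<in> carrier R" "\<one> = v \<otimes> (\<one> \<oplus> j)" by (rule imageE)
  then show ?thesis by (intro that[of v]) simp_all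
qed

text \<open>The left inverse \<open>v\<close> equals 1 - vj, so it has the same shape and a left
  inverse \<open>w\<close> of its own. As \<open>v\<close> also has the right inverse
  \<open>\<one> \<oplus> j\<close>, the two agree.\<close>

lemma one_plus_jacobson_Unit:
  assumes "j \<in> jacobson_radical R"
  shows "\<one> \<oplus> j \<in> Units R"
proof -
  note j = jacobson_radical_closed[OF assms]
  obtain v where v: "v \<in> carrier R" "v \<otimes> (\<one> \<oplus> j) = \<one>"
    using one_plus_jacobson_left_inverse[OF assms] .
  have "v \<oplus> v \<otimes> j = \<one>" using v j by (simp add: r_distr)
  moreover have "v = (v \<oplus> v \<otimes> j) \<oplus> \<ominus> (v \<otimes> j)"
    using v j by (simp add: a_assoc r_neg)
  ultimately have v_eq: "v = \<one> \<oplus> \<ominus> (v \<otimes> j)" by simp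
  have "\<ominus> (v \<otimes> j) \<in> jacobson_radical R"
    using v assms by (intro jacobson_radical_uminus jacobson_radical_mult) auto
  then obtain w where w: "w \<in> carrier R" "w \<otimes> v = \<one>"
    using one_plus_jacobson_left_inverse v_eq by metis
  have "w = \<one> \<oplus> j"
    using v w j by (metis a_closed l_one m_assoc one_closed r_one)
  then show ?thesis
    using v w unfolding Units_def by auto
qed

text \<open>\<open>\<one> \<oplus> \<ominus> e\<close> is a unit that annihilates
  \<open>e\<close>.\<close>

lemma idempotent_jacobson_radical:
  assumes "e \<in> jacobson_radical R" and "e \<otimes> e = e"
  shows "e = \<zero>"
proof -
  note e = jacobson_radical_closed[OF assms(1)]
  have U: "\<one> \<oplus> \<ominus> e \<in> Units R"
    by (intro one_plus_jacobson_Unit jacobson_radical_uminus assms)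
  have "(\<one> \<oplus> \<ominus> e) \<otimes> e = \<zero>"
    using e assms(2) by (simp add: l_distr l_minus r_neg)
  then show ?thesis
    using U e by (metis Units_l_cancel Units_closed r_null zero_closed)
qed

section \<open>The square root of the Jacobson radical\<close>

lemma sqrt_jacobson_closed: "w \<in> sqrt_jacobson R \<Longrightarrow> w \<in> carrier R"
  by (simp add: sqrt_jacobson_def)

lemma jacobson_radical_pow_mono:
  assumes "w \<in> carrier R" and "w [^] (k::nat) \<in> jacobson_radical R" and "k \<le> m"
  shows "w [^] m \<in> jacobson_radical R"
proof -
  have "w [^] m = w [^] (m - k) \<otimes> w [^] k"
    using assms by (simp add: nat_pow_mult)
  then show ?thesis using assms by (simp add: jacobson_radical_mult)
qed

text \<open>Commutation gives \<open>(c \<otimes> w) [^] k = c [^] k \<otimes> w [^] k\<close>,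
  which lies in the left ideal J.\<close>

lemma sqrt_jacobson_mult:
  assumes "w \<in> sqrt_jacobson R" and "c \<in> carrier R" and "c \<otimes> w = w \<otimes> c"
  shows "c \<otimes> w \<in> sqrt_jacobson R"
proof -
  obtain k :: nat where "k \<ge> 1" "w [^] k \<in> jacobson_radical R" "w \<in> carrier R"
    using assms(1) by (auto simp: sqrt_jacobson_def)
  moreover from this have "(c \<otimes> w) [^] k \<in> jacobson_radical R"
    using assms(2) pow_mult_distrib[OF assms(3)] by (simp add: jacobson_radical_mult)
  ultimately show ?thesis
    using assms(2) by (auto simp: sqrt_jacobson_def)
qed

lemma sqrt_jacobson_uminus:
  assumes "w \<in> sqrt_jacobson R" shows "\<ominus> w \<in> sqrt_jacobson R"
  using sqrt_jacobson_mult[OF assms, of "\<ominus> \<one>"] sqrt_jacobson_closed[OF assms]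
  by (simp add: l_minus r_minus)

text \<open>Both directions pass through the exponent \<open>n * k\<close>, which is at least
  \<open>k\<close> because \<open>n\<close> is positive.\<close>

lemma sqrt_jacobson_pow_iff:
  assumes "w \<in> carrier R" and "n \<ge> (1::nat)"
  shows "w [^] n \<in> sqrt_jacobson R \<longleftrightarrow> w \<in> sqrt_jacobson R"
proof
  assume "w [^] n \<in> sqrt_jacobson R"
  then obtain k :: nat where "k \<ge> 1" "w [^] (n * k) \<in> jacobson_radical R"
    using assms by (auto simp: sqrt_jacobson_def nat_pow_pow)
  then show "w \<in> sqrt_jacobson R"
    using assms by (auto simp: sqrt_jacobson_def intro!: exI[of _ "n * k"])
next
  assume "w \<in> sqrt_jacobson R"
  then obtain k :: nat where k: "k \<ge> 1" "w [^] k \<in> jacobson_radical R"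
    by (auto simp: sqrt_jacobson_def)
  then have "w [^] (n * k) \<in> jacobson_radical R"
    using assms by (intro jacobson_radical_pow_mono[OF assms(1) k(2)]) auto
  then show "w [^] n \<in> sqrt_jacobson R"
    using assms k by (auto simp: sqrt_jacobson_def nat_pow_pow)
qed

lemma idempotent_pow:
  assumes "e \<in> carrier R" and "e \<otimes> e = e" and "k \<ge> (1::nat)"
  shows "e [^] k = e"
  using assms(3) by (induction k rule: dec_induct) (use assms in auto)

text \<open>For a common exponent m, the m-th powers of the two components are
  \<open>w [^] m\<close> times \<open>e\<close> and \<open>w [^] m\<close> times
  \<open>\<one> \<ominus> e\<close>, both factors being idempotent, and these add up to
  \<open>w [^] m\<close>.\<close>

lemma sqrt_jacobson_peirce_iff:
  assumes w: "w \<in> carrier R" and e: "e \<in> carrier R" "e \<otimes> e = e" and comm: "w \<otimes> e = e \<otimes> w"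
  shows "w \<in> sqrt_jacobson R \<longleftrightarrow>
           w \<otimes> e \<in> sqrt_jacobson R \<and> w \<otimes> (\<one> \<ominus> e) \<in> sqrt_jacobson R"
proof -
  let ?f = "\<one> \<ominus> e"
  have f: "?f \<in> carrier R" "?f \<otimes> ?f = ?f" "w \<otimes> ?f = ?f \<otimes> w" "e \<oplus> ?f = \<one>"
    using w e comm
    by (simp_all add: minus_eq l_distr r_distr l_minus r_minus r_neg l_neg a_lcomm[of e])
  show ?thesis
  proof
    assume "w \<in> sqrt_jacobson R"
    then show "w \<otimes> e \<in> sqrt_jacobson R \<and> w \<otimes> ?f \<in> sqrt_jacobson R"
      using sqrt_jacobson_mult[of w e] sqrt_jacobson_mult[of w ?f] e f comm by simp
  next
    assume A: "w \<otimes> e \<in> sqrt_jacobson R \<and> w \<otimes> ?f \<in> sqrt_jacobson R"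
    then obtain k l :: nat where kl: "k \<ge> 1" "(w \<otimes> e) [^] k \<in> jacobson_radical R"
      "l \<ge> 1" "(w \<otimes> ?f) [^] l \<in> jacobson_radical R"
      by (auto simp: sqrt_jacobson_def)
    let ?m = "max k l"
    have "(w \<otimes> e) [^] ?m \<in> jacobson_radical R" "(w \<otimes> ?f) [^] ?m \<in> jacobson_radical R"
      using kl w e f by (auto intro: jacobson_radical_pow_mono)
    moreover have "e [^] ?m = e" "?f [^] ?m = ?f"
      using idempotent_pow e f kl by simp_all
    moreover have "(w \<otimes> e) [^] ?m = w [^] ?m \<otimes> e [^] ?m"
        "(w \<otimes> ?f) [^] ?m = w [^] ?m \<otimes> ?f [^] ?m"
      using pow_mult_distrib[OF comm w e(1)] pow_mult_distrib[OF f(3) w f(1)] by simp_all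
    ultimately have "w [^] ?m \<otimes> e \<oplus> w [^] ?m \<otimes> ?f \<in> jacobson_radical R"
      by (metis jacobson_radical_add)
    then have "w [^] ?m \<in> jacobson_radical R"
      using w e f by (simp add: r_distr[symmetric])
    then show "w \<in> sqrt_jacobson R"
      using w kl by (auto simp: sqrt_jacobson_def intro!: exI[of _ ?m])
  qed
qed

text \<open>The witness is the geometric sum of the powers of \<open>t\<close> below
  \<open>k\<close>, built by induction together with its commutation with \<open>t\<close>; that
  commutation later turns a unit product into a unit factor.\<close>

lemma one_minus_pow_factor:
  assumes "t \<in> carrier R"
  shows "\<exists>s\<in>carrier R. t \<otimes> s = s \<otimes> t \<and> \<one> \<oplus> \<ominus> (t [^] (k::nat)) = (\<one> \<oplus> \<ominus> t) \<otimes> s"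
proof (induction k)
  case 0
  then show ?case using assms by (intro bexI[of _ \<zero>]) (auto simp: r_neg)
next
  case (Suc k)
  then obtain s where s: "s \<in> carrier R" "t \<otimes> s = s \<otimes> t"
    "\<one> \<oplus> \<ominus> (t [^] k) = (\<one> \<oplus> \<ominus> t) \<otimes> s" by auto
  have comm: "t \<otimes> t [^] k = t [^] k \<otimes> t"
    using assms by (simp add: nat_pow_comm[of t 1 k, simplified])
  \<comment> \<open>Telescoping: adding the new term raises the exponent from \<open>k\<close> to
    \<open>Suc k\<close>.\<close>
  have "(\<one> \<oplus> \<ominus> (t [^] k)) \<oplus> (\<one> \<oplus> \<ominus> t) \<otimes> t [^] k
      = \<one> \<oplus> ((\<ominus> (t [^] k) \<oplus> t [^] k) \<oplus> \<ominus> (t \<otimes> t [^] k))"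
    using assms by (simp only: l_distr l_minus l_one a_assoc a_closed a_inv_closed m_closed
        nat_pow_closed one_closed)
  then have "\<one> \<oplus> \<ominus> (t [^] Suc k) = (\<one> \<oplus> \<ominus> (t [^] k)) \<oplus> (\<one> \<oplus> \<ominus> t) \<otimes> t [^] k"
    using assms comm by (simp add: l_neg)
  also have "\<dots> = (\<one> \<oplus> \<ominus> t) \<otimes> (s \<oplus> t [^] k)"
    using assms s by (simp add: r_distr)
  finally show ?case
    using assms s comm by (intro bexI[of _ "s \<oplus> t [^] k"]) (auto simp: l_distr r_distr)
qed

text \<open>The inverse \<open>?v\<close> of the product yields a right inverse
  \<open>y \<otimes> ?v\<close> and a left inverse \<open>?v \<otimes> y\<close> of
  \<open>x\<close>, and a left and a right inverse always coincide.\<close>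

lemma Units_of_commuting_product:
  assumes "x \<in> carrier R" "y \<in> carrier R" "x \<otimes> y = y \<otimes> x" "x \<otimes> y \<in> Units R"
  shows "x \<in> Units R"
proof -
  let ?v = "inv (x \<otimes> y)"
  have v: "?v \<in> carrier R" "?v \<otimes> (x \<otimes> y) = \<one>" "(x \<otimes> y) \<otimes> ?v = \<one>"
    using assms(4) by auto
  have r: "x \<otimes> (y \<otimes> ?v) = \<one>" using v assms(1,2) by (simp add: m_assoc)
  have l: "(?v \<otimes> y) \<otimes> x = \<one>" using v assms(1,2) by (simp add: m_assoc assms(3)[symmetric])
  have "?v \<otimes> y = y \<otimes> ?v"
    using inv_unique[OF l r] v assms(1,2) by simp
  then show ?thesis
    using l r v assms unfolding Units_def by auto
qed

text \<open>The element \<open>w\<close> is nilpotent modulo J. With t = -w and a suitable k, the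
  unit 1 - t^k factors as 1 - t times a commuting cofactor, so 1 - t is a unit as well.\<close>

lemma one_plus_sqrt_jacobson_Unit:
  assumes "w \<in> sqrt_jacobson R"
  shows "\<one> \<oplus> w \<in> Units R"
proof -
  define t where "t = \<ominus> w"
  have "t \<in> sqrt_jacobson R" unfolding t_def by (rule sqrt_jacobson_uminus[OF assms])
  then obtain k :: nat where t: "t \<in> carrier R" "t [^] k \<in> jacobson_radical R"
    by (auto simp: sqrt_jacobson_def)
  obtain s where s: "s \<in> carrier R" "t \<otimes> s = s \<otimes> t"
    "\<one> \<oplus> \<ominus> (t [^] k) = (\<one> \<oplus> \<ominus> t) \<otimes> s"
    using one_minus_pow_factor[OF t(1)] by blast
  have "(\<one> \<oplus> \<ominus> t) \<otimes> s \<in> Units R"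
    using one_plus_jacobson_Unit[OF jacobson_radical_uminus[OF t(2)]] s(3) by simp
  moreover have "(\<one> \<oplus> \<ominus> t) \<otimes> s = s \<otimes> (\<one> \<oplus> \<ominus> t)"
    using s(1,2) t(1) by (simp add: l_distr r_distr l_minus r_minus)
  ultimately have "\<one> \<oplus> \<ominus> t \<in> Units R"
    using Units_of_commuting_product[OF _ s(1)] t(1) by (metis a_closed a_inv_closed one_closed)
  then show ?thesis unfolding t_def using sqrt_jacobson_closed[OF assms] by simp
qed

section \<open>The bicommutant as a commutative subring closed under inverses\<close>

lemma comm2_commute:
  "y \<in> comm2 R x \<Longrightarrow> z \<in> carrier R \<Longrightarrow> x \<otimes> z = z \<otimes> x \<Longrightarrow> y \<otimes> z = z \<otimes> y"
  by (simp add: comm2_def comm_def)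

lemma comm2_closed: "y \<in> comm2 R x \<Longrightarrow> y \<in> carrier R"
  by (simp add: comm2_def)

lemma comm2I:
  "y \<in> carrier R \<Longrightarrow> (\<And>z. z \<in> carrier R \<Longrightarrow> x \<otimes> z = z \<otimes> x \<Longrightarrow> y \<otimes> z = z \<otimes> y) \<Longrightarrow> y \<in> comm2 R x"
  by (simp add: comm2_def comm_def)

lemma comm2_self: "x \<in> carrier R \<Longrightarrow> x \<in> comm2 R x"
  by (simp add: comm2_def comm_def)

text \<open>\<open>z\<close> commutes with \<open>x\<close>, because \<open>x\<close> lies in its
  own commutant; so \<open>z\<close> is among the elements with which \<open>y\<close> has to
  commute.\<close>

lemma comm2_commutative:
  assumes "x \<in> carrier R" "y \<in> comm2 R x" "z \<in> comm2 R x" shows "y \<otimes> z = z \<otimes> y"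
  using comm2_commute[OF assms(2) comm2_closed[OF assms(3)]] comm2_commute[OF assms(3,1)] by simp

lemma comm2_mult:
  assumes "y \<in> comm2 R x" "z \<in> comm2 R x" shows "y \<otimes> z \<in> comm2 R x"
proof (rule comm2I)
  fix c assume c: "c \<in> carrier R" "x \<otimes> c = c \<otimes> x"
  note closed = c(1) assms[THEN comm2_closed]
  have "y \<otimes> z \<otimes> c = y \<otimes> c \<otimes> z"
    using closed comm2_commute[OF assms(2) c] by (simp add: m_assoc)
  then show "y \<otimes> z \<otimes> c = c \<otimes> (y \<otimes> z)"
    using closed comm2_commute[OF assms(1) c] by (simp add: m_assoc)
qed (use assms[THEN comm2_closed] in auto)

lemma comm2_add:
  assumes "y \<in> comm2 R x" "z \<in> comm2 R x" shows "y \<oplus> z \<in> comm2 R x"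
  using assms[THEN comm2_closed] comm2_commute[OF assms(1)] comm2_commute[OF assms(2)]
  by (auto intro!: comm2I simp: l_distr r_distr)

lemma comm2_uminus:
  assumes "y \<in> comm2 R x" shows "\<ominus> y \<in> comm2 R x"
  using assms[THEN comm2_closed] comm2_commute[OF assms]
  by (auto intro!: comm2I simp: l_minus r_minus)

lemma comm2_one: "\<one> \<in> comm2 R x"
  by (auto intro: comm2I)

lemma comm2_pow: "y \<in> comm2 R x \<Longrightarrow> y [^] (k::nat) \<in> comm2 R x"
  by (induction k) (auto intro: comm2_one comm2_mult)

text \<open>Multiply \<open>u \<otimes> c = c \<otimes> u\<close> by \<open>inv u\<close> on both
  sides. This keeps the inverse constructed from an idempotent inside the bicommutant.\<close>

lemma comm2_inv:
  assumes "u \<in> comm2 R x" "u \<in> Units R" shows "inv u \<in> comm2 R x"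
proof (rule comm2I)
  fix c assume c: "c \<in> carrier R" "x \<otimes> c = c \<otimes> x"
  have "inv u \<otimes> c = inv u \<otimes> (c \<otimes> u) \<otimes> inv u"
    using c(1) assms(2) by (simp add: m_assoc Units_closed)
  also have "\<dots> = inv u \<otimes> (u \<otimes> c) \<otimes> inv u"
    using comm2_commute[OF assms(1) c] by simp
  also have "\<dots> = c \<otimes> inv u"
    using c(1) assms(2) by (simp add: m_assoc[symmetric] Units_closed)
  finally show "inv u \<otimes> c = c \<otimes> inv u" .
qed (use assms in auto)

section \<open>Uniqueness and construction of the pns-Drazin inverse\<close>

lemma pns_drazin_inverse_commute:
  assumes "is_pns_drazin_inverse R n a x" "a \<in> carrier R"
  shows "x \<otimes> a = a \<otimes> x"
  using assms comm2_commute[of x a a] by (simp add: is_pns_drazin_inverse_def)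

text \<open>Let p = ax and q = ay. The idempotent p(1 - q) is a multiple of a^n - q by a commuting
  factor, so it lies in J and vanishes. By symmetry p = q, and an inverse is determined by its
  idempotent.\<close>

lemma pns_drazin_inverse_unique:
  assumes n: "n \<ge> 1" and a: "a \<in> carrier R"
    and x: "is_pns_drazin_inverse R n a x" and y: "is_pns_drazin_inverse R n a y"
  shows "x = y"
proof -
  \<comment> \<open>Proved for an arbitrary pair of inverses, so that it can be used in both
    orders.\<close>
  have absorb: "a \<otimes> x \<otimes> (a \<otimes> y) = a \<otimes> x"
    if x: "is_pns_drazin_inverse R n a x" and y: "is_pns_drazin_inverse R n a y" for x y
  proof -
    let ?p = "a \<otimes> x" and ?q = "a \<otimes> y"
    let ?f = "\<one> \<ominus> ?q" and ?w = "a [^] n \<ominus> ?q"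
    have c: "x \<in> carrier R" "y \<in> carrier R" and xax: "x \<otimes> a \<otimes> x = x" and yay: "y \<otimes> a \<otimes> y = y"
      and w: "?w \<in> sqrt_jacobson R"
      using x y by (auto simp: is_pns_drazin_inverse_def)
    have x2: "x \<in> comm2 R a" and y2: "y \<in> comm2 R a"
      using x y by (auto simp: is_pns_drazin_inverse_def)
    note a2 = comm2_self[OF a]
    note commute = comm2_commutative[OF a]
    have f2: "?f \<in> comm2 R a" and w2: "?w \<in> comm2 R a" and p2: "?p \<in> comm2 R a" and q2: "?q \<in> comm2 R a"
      unfolding minus_eq
      by (intro comm2_add comm2_uminus comm2_one comm2_mult comm2_pow a2 x2 y2)+
    note closed = f2[THEN comm2_closed] w2[THEN comm2_closed] p2[THEN comm2_closed] q2[THEN comm2_closed]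
    have pp: "?p \<otimes> ?p = ?p" and qq: "?q \<otimes> ?q = ?q"
      using a c xax yay by (simp_all add: m_assoc)
    have ff: "?f \<otimes> ?f = ?f" and qf: "?q \<otimes> ?f = \<zero>"
      using closed qq by (simp_all add: minus_eq l_distr r_distr l_minus r_minus r_neg l_neg)
    \<comment> \<open>An idempotent equals its own n-th power for positive n; this makes
      \<open>a [^] n\<close> appear as a factor.\<close>
    have p_pow: "?p = x [^] n \<otimes> a [^] n"
      using idempotent_pow[OF _ pp n] a c commute[OF a2 x2]
      by (simp add: pow_mult_distrib[symmetric])
    \<comment> \<open>Since \<open>?q \<otimes> ?f = \<zero>\<close>, \<open>a [^] n\<close> may be
      replaced by \<open>?w\<close> in front of \<open>?f\<close>.\<close>
    have "?p \<otimes> ?f = x [^] n \<otimes> (?w \<otimes> ?f)"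
      unfolding p_pow using qf a c closed
      by (simp add: m_assoc minus_eq[of "a [^] n"] l_distr l_minus)
    also have "\<dots> = (x [^] n \<otimes> ?f) \<otimes> ?w"
      using commute[OF w2 f2] closed c by (simp add: m_assoc)
    finally have pf: "?p \<otimes> ?f = (x [^] n \<otimes> ?f) \<otimes> ?w" .
    have "x [^] n \<otimes> ?f \<in> comm2 R a"
      by (intro comm2_mult comm2_pow x2 f2)
    from sqrt_jacobson_mult[OF w comm2_closed[OF this] commute[OF this w2]]
    have "?p \<otimes> ?f \<in> sqrt_jacobson R" unfolding pf .
    moreover have pfpf: "(?p \<otimes> ?f) \<otimes> (?p \<otimes> ?f) = ?p \<otimes> ?f"
    proof -
      have "(?p \<otimes> ?f) \<otimes> (?p \<otimes> ?f) = ?p \<otimes> (?f \<otimes> ?p) \<otimes> ?f"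
        using closed by (simp only: m_assoc m_closed)
      also have "\<dots> = (?p \<otimes> ?p) \<otimes> (?f \<otimes> ?f)"
        unfolding commute[OF f2 p2] using closed by (simp only: m_assoc m_closed)
      finally show ?thesis unfolding pp ff .
    qed
    \<comment> \<open>All positive powers of an idempotent coincide, so one in the square root of J
      lies in J itself.\<close>
    ultimately have "?p \<otimes> ?f \<in> jacobson_radical R"
      using idempotent_pow[OF _ pfpf] closed by (auto simp: sqrt_jacobson_def)
    then have "?p \<otimes> ?f = \<zero>"
      using pfpf by (rule idempotent_jacobson_radical)
    then have "?p \<ominus> ?p \<otimes> ?q = \<zero>"
      using closed by (simp add: minus_eq r_distr r_minus)
    then show ?thesis
      using closed by simp
  qed
  have c: "x \<in> carrier R" "y \<in> carrier R" and xax: "x \<otimes> a \<otimes> x = x" and yay: "y \<otimes> a \<otimes> y = y"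
    and x2: "x \<in> comm2 R a" and y2: "y \<in> comm2 R a"
    using x y by (auto simp: is_pns_drazin_inverse_def)
  have xa: "x \<otimes> a = a \<otimes> x" and ya: "y \<otimes> a = a \<otimes> y"
    using pns_drazin_inverse_commute a x y by auto
  have "a \<otimes> x \<otimes> (a \<otimes> y) = a \<otimes> y \<otimes> (a \<otimes> x)"
    by (intro comm2_commutative[OF a] comm2_mult comm2_self a x2 y2)
  then have pq: "a \<otimes> x = a \<otimes> y"
    using absorb[OF x y] absorb[OF y x] by simp
  have "x = x \<otimes> (a \<otimes> y)" using xax pq a c by (simp add: m_assoc)
  also have "\<dots> = (a \<otimes> y) \<otimes> y" using xa pq a c by (simp add: m_assoc[symmetric])
  also have "\<dots> = y" using yay ya by simp
  finally show ?thesis .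
qed

lemma pns_drazin_inverse_eqI:
  assumes "n \<ge> 1" "a \<in> carrier R" "is_pns_drazin_inverse R n a x"
  shows "pns_drazin_inverse R n a = x"
  unfolding pns_drazin_inverse_def
  using assms by (intro the_equality) (auto intro: pns_drazin_inverse_unique)

lemma is_pns_drazin_inverse_pns_drazin_inverse:
  assumes "n \<ge> 1" "a \<in> carrier R" "pns_drazin_invertible R n a"
  shows "is_pns_drazin_inverse R n a (pns_drazin_inverse R n a)"
  using assms pns_drazin_inverse_eqI by (auto simp: pns_drazin_invertible_def)

lemma pns_drazin_inverse_from_idempotent:
  assumes n: "n \<ge> 1" and b: "b \<in> carrier R" and p2: "p \<in> comm2 R b" and pp: "p \<otimes> p = p"
    and w: "b [^] n \<ominus> p \<in> sqrt_jacobson R"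
  obtains y where "is_pns_drazin_inverse R n b y" and "b \<otimes> y = p"
proof -
  note b2 = comm2_self[OF b] and p = comm2_closed[OF p2]
  define u where "u = \<one> \<oplus> (b [^] n \<ominus> p)"
  have u2: "u \<in> comm2 R b"
    unfolding u_def minus_eq by (intro comm2_add comm2_uminus comm2_one comm2_pow b2 p2)
  have u: "u \<in> Units R" unfolding u_def by (rule one_plus_sqrt_jacobson_Unit[OF w])
  let ?y = "b [^] (n - 1) \<otimes> (inv u \<otimes> p)"
  have y2: "?y \<in> comm2 R b"
    by (intro comm2_mult comm2_pow comm2_inv b2 p2 u2 u)
  note commute = comm2_commutative[OF b]
  have up: "u \<otimes> p = b [^] n \<otimes> p"
    using b p pp unfolding u_def minus_eq
    by (simp add: l_distr l_minus a_lcomm[of p] r_neg)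
  \<comment> \<open>The subtraction \<open>n - 1\<close> is truncated; \<open>n \<ge> 1\<close>
    ensures that multiplying by \<open>b\<close> restores \<open>b [^] n\<close>.\<close>
  have "b [^] n = b \<otimes> b [^] (n - 1)"
    using n b nat_pow_mult[of b 1 "n - 1"] by simp
  then have "b \<otimes> ?y = b [^] n \<otimes> inv u \<otimes> p"
    using b p u by (simp add: m_assoc)
  also have "\<dots> = inv u \<otimes> (b [^] n \<otimes> p)"
    using commute[OF comm2_pow[OF b2] comm2_inv[OF u2 u], of n] b p u by (simp add: m_assoc)
  also have "\<dots> = p" using u p by (simp add: up[symmetric] m_assoc[symmetric] Units_closed)
  finally have y_eq: "b \<otimes> ?y = p" .
  have "?y \<otimes> b \<otimes> ?y = ?y \<otimes> p"
    using y_eq b comm2_closed[OF y2] by (simp add: m_assoc)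
  also have "\<dots> = ?y" using pp b p u by (simp add: m_assoc)
  finally have "is_pns_drazin_inverse R n b ?y"
    using y2 y_eq w comm2_closed[OF y2] by (simp add: is_pns_drazin_inverse_def)
  with y_eq that show ?thesis by blast
qed


text \<open>Meant for the idempotent of \<open>a\<close> in the role of \<open>p\<close>. In the
  backward direction, uniqueness identifies the inverse constructed from \<open>p\<close> with the
  one that \<open>pns_drazin_inverse\<close> selects.\<close>

lemma pns_idempotent_eq_iff:
  assumes n: "n \<ge> 1" and b: "b \<in> carrier R" and p: "p \<in> carrier R" "p \<otimes> p = p"
  shows "pns_drazin_invertible R n b \<and> p = pns_idempotent R n b \<longleftrightarrow>
           p \<in> comm2 R b \<and> b [^] n \<ominus> p \<in> sqrt_jacobson R" (is "?lhs \<longleftrightarrow> ?rhs")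
proof
  assume ?lhs
  then show ?rhs
    using is_pns_drazin_inverse_pns_drazin_inverse[OF n b] comm2_self[OF b]
    by (auto simp: is_pns_drazin_inverse_def pns_idempotent_def intro: comm2_mult)
next
  assume ?rhs
  then obtain y where "is_pns_drazin_inverse R n b y" "b \<otimes> y = p"
    using pns_drazin_inverse_from_idempotent[OF n b _ p(2)] by blast
  then show ?lhs
    using pns_drazin_inverse_eqI[OF n b]
    by (auto simp: pns_drazin_invertible_def pns_idempotent_def)
qed

text \<open>The Peirce component of b^n - p at p is the negative of (1 - b^n)p. The one at 1 - p is
  b^n(1 - p) = (b(1 - p))^n, where the n-th power does not affect membership in the square root of
  J.\<close>

lemma pow_minus_idempotent_sqrt_jacobson_iff:
  assumes n: "n \<ge> (1::nat)" and b: "b \<in> carrier R"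
    and p: "p \<in> carrier R" "p \<otimes> p = p" and comm: "b \<otimes> p = p \<otimes> b"
  shows "b [^] n \<ominus> p \<in> sqrt_jacobson R \<longleftrightarrow>
           b \<otimes> (\<one> \<ominus> p) \<in> sqrt_jacobson R \<and> (\<one> \<ominus> b [^] n) \<otimes> p \<in> sqrt_jacobson R"
proof -
  let ?w = "b [^] n \<ominus> p" and ?f = "\<one> \<ominus> p"
  have bn: "b [^] n \<otimes> p = p \<otimes> b [^] n"
    using group_commutes_pow[OF comm b p(1)] .
  have f: "?f \<in> carrier R" "?f \<otimes> ?f = ?f" "p \<otimes> ?f = \<zero>" "b \<otimes> ?f = ?f \<otimes> b"
    using b p comm by (simp_all add: minus_eq l_distr r_distr l_minus r_minus r_neg l_neg)
  have "?w \<otimes> p = \<ominus> ((\<one> \<ominus> b [^] n) \<otimes> p)"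
    using b p by (simp add: minus_eq l_distr l_minus minus_add a_comm)
  then have wp: "?w \<otimes> p \<in> sqrt_jacobson R \<longleftrightarrow> (\<one> \<ominus> b [^] n) \<otimes> p \<in> sqrt_jacobson R"
    using sqrt_jacobson_uminus[of "?w \<otimes> p"] sqrt_jacobson_uminus[of "(\<one> \<ominus> b [^] n) \<otimes> p"] b p
    by auto
  have "?w \<otimes> ?f = b [^] n \<otimes> ?f"
    using b p f(1,3) by (simp add: minus_eq[of "b [^] n"] l_distr l_minus)
  also have "\<dots> = (b \<otimes> ?f) [^] n"
    using idempotent_pow[OF f(1,2) n] pow_mult_distrib[OF f(4) b f(1)] by simp
  finally have "?w \<otimes> ?f \<in> sqrt_jacobson R \<longleftrightarrow> b \<otimes> ?f \<in> sqrt_jacobson R"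
    using sqrt_jacobson_pow_iff[OF _ n, of "b \<otimes> ?f"] b f(1) by simp
  moreover have "?w \<in> carrier R" "?w \<otimes> p = p \<otimes> ?w"
    using b p bn by (simp_all add: minus_eq l_distr r_distr l_minus r_minus)
  ultimately show ?thesis
    using sqrt_jacobson_peirce_iff[OF _ p] wp by blast
qed

end

section \<open>Commuting outer inverses and the equality of their idempotents\<close>

definition commuting_outer_inverse :: "('a, 'b) ring_scheme \<Rightarrow> 'a \<Rightarrow> 'a \<Rightarrow> bool" where
  "commuting_outer_inverse R a x \<longleftrightarrow>
     a \<in> carrier R \<and> x \<in> carrier R \<and> x \<otimes>\<^bsub>R\<^esub> a = a \<otimes>\<^bsub>R\<^esub> x \<and> x \<otimes>\<^bsub>R\<^esub> a \<otimes>\<^bsub>R\<^esub> x = x"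

context ring
begin

text \<open>Passes to the purely multiplicative relations on which the comparison of conditions (4),
  (5) and (7) with equality of idempotents rests.\<close>

lemma commuting_outer_inverse_pns_drazin_inverse:
  "is_pns_drazin_inverse R n a x \<Longrightarrow> a \<in> carrier R \<Longrightarrow> commuting_outer_inverse R a x"
  using pns_drazin_inverse_commute[of n a x]
  by (simp add: commuting_outer_inverse_def is_pns_drazin_inverse_def)

lemma commuting_outer_inverseD:
  assumes "commuting_outer_inverse R a x"
  shows "a \<in> carrier R" and "x \<in> carrier R" and "x \<otimes> a = a \<otimes> x"
    and "a \<otimes> x \<otimes> x = x" and "x \<otimes> (a \<otimes> x) = x" and "a \<otimes> x \<otimes> (a \<otimes> x) = a \<otimes> x"
    and "a \<otimes> (a \<otimes> x) = a \<otimes> x \<otimes> a"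
proof -
  have xax: "x \<otimes> a \<otimes> x = x"
    using assms unfolding commuting_outer_inverse_def by blast
  show *: "a \<in> carrier R" "x \<in> carrier R" "x \<otimes> a = a \<otimes> x"
    using assms by (simp_all add: commuting_outer_inverse_def)
  show "a \<otimes> x \<otimes> x = x"
    using xax *(3) by simp
  show "x \<otimes> (a \<otimes> x) = x"
    using xax *(1,2) by (simp add: m_assoc)
  then show "a \<otimes> x \<otimes> (a \<otimes> x) = a \<otimes> x"
    using * by (simp add: m_assoc)
  show "a \<otimes> (a \<otimes> x) = a \<otimes> x \<otimes> a"
    using * by (simp add: m_assoc)
qed

context
  fixes a x b y
  assumes x: "commuting_outer_inverse R a x" and y: "commuting_outer_inverse R b y"
begin

text \<open>By the first law the product of the two idempotents is \<open>a \<otimes> x\<close>;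
  after exchanging \<open>b\<close> and \<open>y\<close>, the second law makes the same product
  equal to \<open>b \<otimes> y\<close>.\<close>

lemma outer_inverse_idempotents_eqI:
  assumes "x \<otimes> (b \<otimes> y) = x" and "a \<otimes> x \<otimes> y = y"
  shows "a \<otimes> x = b \<otimes> y"
proof -
  note X = commuting_outer_inverseD[OF x] and Y = commuting_outer_inverseD[OF y]
  have "a \<otimes> x = a \<otimes> x \<otimes> (b \<otimes> y)"
    using X(1,2) Y(1,2) assms(1) by (simp add: m_assoc)
  also have "\<dots> = a \<otimes> x \<otimes> y \<otimes> b"
    using X(1,2) Y(1,2) by (simp add: m_assoc Y(3))
  also have "\<dots> = b \<otimes> y" by (simp add: assms(2) Y(3))
  finally show ?thesis .
qed

text \<open>With p = ax, the element to be inverted is v = (1 - p) + xb. If the idempotents agree,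
  xb and ya are mutually inverse in the corner ring of p, so (1 - p) + ya inverts v, and it sends x
  to y. Conversely, vy = x splits into (1 - p)y = 0 and x(by) = x, which are the absorption
  laws.\<close>

lemma outer_inverse_idempotents_eq_iff_Unit:
  "a \<otimes> x = b \<otimes> y \<longleftrightarrow>
     \<one> \<ominus> a \<otimes> x \<otimes> (\<one> \<ominus> x \<otimes> b) \<in> Units R \<and> y = inv (\<one> \<ominus> a \<otimes> x \<otimes> (\<one> \<ominus> x \<otimes> b)) \<otimes> x"
proof -
  note X = commuting_outer_inverseD[OF x] and Y = commuting_outer_inverseD[OF y]
  define p where "p = a \<otimes> x"
  define v where "v = \<one> \<ominus> p \<otimes> (\<one> \<ominus> x \<otimes> b)"
  let ?f = "\<one> \<ominus> p"
  have p: "p \<in> carrier R" "p \<otimes> p = p" "p \<otimes> x = x" "x \<otimes> p = x" "x \<otimes> a = p"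
    unfolding p_def using X by auto
  note [simp] = X(1,2) Y(1,2) p(1)
  have f: "?f \<in> carrier R" "?f \<otimes> ?f = ?f" "?f \<otimes> x = \<zero>" "x \<otimes> ?f = \<zero>" "?f \<oplus> p = \<one>"
    "p \<otimes> ?f = \<zero>"
    using p(2-4) by (simp_all add: minus_eq l_distr r_distr l_minus r_minus r_neg l_neg a_assoc)
  have "v = \<one> \<oplus> (\<ominus> p \<oplus> p \<otimes> (x \<otimes> b))"
    by (simp add: v_def minus_eq r_distr r_minus minus_add)
  also have "p \<otimes> (x \<otimes> b) = x \<otimes> b" using p(3) by (simp add: m_assoc[symmetric])
  finally have v: "v = ?f \<oplus> x \<otimes> b" by (simp add: minus_eq a_assoc)
  note [simp] = f(1)
  have [simp]: "v \<in> carrier R" by (simp add: v)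
  have "p = b \<otimes> y \<longleftrightarrow> v \<in> Units R \<and> y = inv v \<otimes> x"
  proof
    assume q: "p = b \<otimes> y"
    then have yp: "y \<otimes> p = y" "p \<otimes> y = y" "y \<otimes> b = p" "b \<otimes> p = p \<otimes> b"
      using Y by auto
    have fy: "?f \<otimes> y = \<zero>" "y \<otimes> ?f = \<zero>" "b \<otimes> ?f = ?f \<otimes> b"
      using yp(1,2,4) by (simp_all add: minus_eq l_distr r_distr l_minus r_minus r_neg)
    have fa: "a \<otimes> ?f = ?f \<otimes> a"
      using X(7) by (simp add: minus_eq l_distr r_distr l_minus r_minus p_def)
    \<comment> \<open>The candidate for the inverse of \<open>v\<close>. All mixed products vanish,
      since \<open>?f\<close> commutes with \<open>a\<close> and \<open>b\<close> and annihilates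
      \<open>x\<close> and \<open>y\<close> from both sides.\<close>
    let ?w = "?f \<oplus> y \<otimes> a"
    have "x \<otimes> b \<otimes> (y \<otimes> a) = x \<otimes> (b \<otimes> y) \<otimes> a" by (simp add: m_assoc)
    then have xbya: "x \<otimes> b \<otimes> (y \<otimes> a) = p" using p by (simp add: q[symmetric])
    have "y \<otimes> a \<otimes> (x \<otimes> b) = y \<otimes> (a \<otimes> x) \<otimes> b" by (simp add: m_assoc)
    then have yaxb: "y \<otimes> a \<otimes> (x \<otimes> b) = p" using yp by (simp add: p_def[symmetric])
    have "?f \<otimes> (y \<otimes> a) = \<zero>" "?f \<otimes> (x \<otimes> b) = \<zero>"
      using fy(1) f(3) by (simp_all add: m_assoc[symmetric])
    moreover have "x \<otimes> b \<otimes> ?f = \<zero>"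
    proof -
      have "x \<otimes> b \<otimes> ?f = (x \<otimes> ?f) \<otimes> b" by (simp add: m_assoc fy(3))
      then show ?thesis by (simp add: f(4))
    qed
    moreover have "y \<otimes> a \<otimes> ?f = \<zero>"
    proof -
      have "y \<otimes> a \<otimes> ?f = (y \<otimes> ?f) \<otimes> a" by (simp add: m_assoc fa)
      then show ?thesis by (simp add: fy(2))
    qed
    ultimately have vw: "v \<otimes> ?w = \<one>" and wv: "?w \<otimes> v = \<one>"
      unfolding v using xbya yaxb f(2,5) by (simp_all add: l_distr r_distr)
    have wx: "?w \<otimes> x = y"
      using f(3) yp(1) by (simp add: l_distr m_assoc p_def[symmetric])
    have "v \<in> Units R" using vw wv by (auto simp: Units_def)
    moreover have "inv v = ?w" using inv_unique'[OF _ _ vw wv] by simp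
    ultimately show "v \<in> Units R \<and> y = inv v \<otimes> x" using wx by simp
  next
    assume "v \<in> Units R \<and> y = inv v \<otimes> x"
    then have "v \<otimes> y = x" by (simp add: m_assoc[symmetric])
    then have vy: "?f \<otimes> y \<oplus> x \<otimes> (b \<otimes> y) = x" by (simp add: v l_distr m_assoc)
    \<comment> \<open>Left multiplication by \<open>p\<close> kills the \<open>?f\<close> component
      and fixes the other one, separating the two absorption laws.\<close>
    then have "p \<otimes> (?f \<otimes> y \<oplus> x \<otimes> (b \<otimes> y)) = x" by (simp add: p(3))
    then have xq: "x \<otimes> (b \<otimes> y) = x"
      using f(6) p(3) by (simp add: r_distr m_assoc[symmetric])
    then have "?f \<otimes> y = \<zero>" using vy by (simp add: add.l_cancel_one)
    then have "p \<otimes> y = y" by (simp add: minus_eq l_distr l_minus r_right_minus_eq[unfolded minus_eq])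
    then show "p = b \<otimes> y"
      using outer_inverse_idempotents_eqI xq by (simp add: p_def)
  qed
  then show ?thesis by (simp add: p_def v_def)
qed

text \<open>As \<open>x\<close> commutes with \<open>a\<close>, the right-hand side is (ax)y -
  x(by). Left multiplication by ax fixes it but turns y - x into (ax)y - x. Comparison gives x(by) =
  x, and then the equation itself gives (ax)y = y.\<close>

lemma outer_inverse_idempotents_eq_iff_diff:
  "a \<otimes> x = b \<otimes> y \<longleftrightarrow> y \<ominus> x = x \<otimes> (a \<ominus> b) \<otimes> y"
proof -
  note X = commuting_outer_inverseD[OF x] and Y = commuting_outer_inverseD[OF y]
  note [simp] = X(1,2) Y(1,2)
  have rhs: "x \<otimes> (a \<ominus> b) \<otimes> y = a \<otimes> x \<otimes> y \<ominus> x \<otimes> (b \<otimes> y)"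
    by (simp add: minus_eq l_distr r_distr l_minus r_minus X(3) m_assoc[of x b y])
  show ?thesis
  proof
    assume "a \<otimes> x = b \<otimes> y"
    then show "y \<ominus> x = x \<otimes> (a \<ominus> b) \<otimes> y"
      unfolding rhs using X(5) Y(4) by metis
  next
    assume "y \<ominus> x = x \<otimes> (a \<ominus> b) \<otimes> y"
    then have eq: "y \<ominus> x = a \<otimes> x \<otimes> y \<ominus> x \<otimes> (b \<otimes> y)"
      unfolding rhs .
    have "a \<otimes> x \<otimes> (y \<ominus> x) = a \<otimes> x \<otimes> (a \<otimes> x \<otimes> y \<ominus> x \<otimes> (b \<otimes> y))"
      using eq by simp
    then have "a \<otimes> x \<otimes> y \<ominus> x = a \<otimes> x \<otimes> y \<ominus> x \<otimes> (b \<otimes> y)"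
      using X(4,6) by (simp add: minus_eq r_distr r_minus m_assoc[symmetric])
    then have xq: "x \<otimes> (b \<otimes> y) = x"
      by (simp add: minus_eq) (metis X(2) Y(1,2) m_closed minus_minus)
    then have "a \<otimes> x \<otimes> y = y"
      using eq by (simp add: minus_eq add.r_cancel)
    with xq show "a \<otimes> x = b \<otimes> y" by (rule outer_inverse_idempotents_eqI)
  qed
qed

text \<open>Inclusion of the right ideals makes y a right multiple of x, so ax fixes y from the
  left. Inclusion of the annihilators, applied to 1 - by, gives x(by) = x.\<close>

lemma outer_inverse_idempotents_eq_iff_subset:
  "a \<otimes> x = b \<otimes> y \<longleftrightarrow>
     y <# carrier R \<subseteq> x <# carrier R \<and> right_annihilator R y \<subseteq> right_annihilator R x"
proof -
  note X = commuting_outer_inverseD[OF x] and Y = commuting_outer_inverseD[OF y]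
  note [simp] = X(1,2) Y(1,2)
  show ?thesis
  proof
    assume eq: "a \<otimes> x = b \<otimes> y"
    have "y \<otimes> r \<in> x <# carrier R" if "r \<in> carrier R" for r
    proof -
      \<comment> \<open>From y = (by)y = (ax)y = (xa)y.\<close>
      have "y = x \<otimes> (a \<otimes> y)" using eq Y(4) X(3) by (simp add: m_assoc[symmetric])
      then have "y \<otimes> r = x \<otimes> (a \<otimes> y \<otimes> r)" using that by (metis X(1,2) Y(2) m_assoc m_closed)
      then show ?thesis using that by (auto simp: l_coset_def)
    qed
    moreover have "x \<otimes> r = \<zero>" if "r \<in> carrier R" "y \<otimes> r = \<zero>" for r
    proof -
      have "x \<otimes> r = x \<otimes> (b \<otimes> y) \<otimes> r" using X(5) eq by simp
      also have "\<dots> = x \<otimes> b \<otimes> (y \<otimes> r)" using that(1) by (simp add: m_assoc)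
      finally show ?thesis using that(2) by simp
    qed
    ultimately show "y <# carrier R \<subseteq> x <# carrier R \<and> right_annihilator R y \<subseteq> right_annihilator R x"
      by (auto simp: l_coset_def right_annihilator_def)
  next
    assume sub: "y <# carrier R \<subseteq> x <# carrier R \<and> right_annihilator R y \<subseteq> right_annihilator R x"
    have "y \<otimes> \<one> \<in> y <# carrier R" unfolding l_coset_def by blast
    then obtain r where r: "r \<in> carrier R" "y = x \<otimes> r"
      using sub by (auto simp: l_coset_def)
    then have "a \<otimes> x \<otimes> y = y"
      using X(4) by (simp add: m_assoc[symmetric])
    moreover have "y \<otimes> (\<one> \<ominus> b \<otimes> y) = \<zero>"
      using Y(5) by (simp add: minus_eq r_distr r_minus r_neg)
    then have "\<one> \<ominus> b \<otimes> y \<in> right_annihilator R y"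
      by (simp add: right_annihilator_def)
    then have "\<one> \<ominus> b \<otimes> y \<in> right_annihilator R x"
      using sub by blast
    then have "x \<ominus> x \<otimes> (b \<otimes> y) = \<zero>"
      by (simp add: right_annihilator_def minus_eq r_distr r_minus)
    then have "x \<otimes> (b \<otimes> y) = x" by simp
    ultimately show "a \<otimes> x = b \<otimes> y"
      by (intro outer_inverse_idempotents_eqI)
  qed
qed

end

text \<open>For commuting idempotents, d = p - q satisfies d * d * d = d, hence (1 - d * d) * d = 0.\<close>

lemma commuting_idempotents_eq_iff:
  assumes p: "p \<in> carrier R" "p \<otimes> p = p" and q: "q \<in> carrier R" "q \<otimes> q = q"
  shows "p = q \<longleftrightarrow> p \<otimes> q = q \<otimes> p \<and> \<one> \<ominus> (p \<ominus> q) [^] (2::nat) \<in> Units R"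
proof
  assume "p = q"
  then show "p \<otimes> q = q \<otimes> p \<and> \<one> \<ominus> (p \<ominus> q) [^] (2::nat) \<in> Units R"
    using p by (simp add: minus_eq r_neg numeral_2_eq_2)
next
  assume A: "p \<otimes> q = q \<otimes> p \<and> \<one> \<ominus> (p \<ominus> q) [^] (2::nat) \<in> Units R"
  let ?d = "p \<ominus> q"
  have pqp: "p \<otimes> q \<otimes> p = p \<otimes> q" and pqq: "p \<otimes> q \<otimes> q = p \<otimes> q"
    using p q A by (metis m_assoc)+
  \<comment> \<open>The square is a sum of two orthogonal idempotents; a further factor
    \<open>?d\<close> fixes the first and negates the second, which gives back
    \<open>?d\<close>.\<close>
  have dd: "?d \<otimes> ?d = (p \<ominus> p \<otimes> q) \<oplus> (q \<ominus> p \<otimes> q)"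
    using p q A by (simp add: minus_eq l_distr r_distr l_minus r_minus minus_add a_ac)
  have 1: "(p \<ominus> p \<otimes> q) \<otimes> ?d = p \<ominus> p \<otimes> q"
    using p q A pqp pqq by (simp add: minus_eq l_distr r_distr l_minus r_minus r_neg l_neg)
  have "q \<otimes> p = p \<otimes> q" using A by simp
  then have 2: "(q \<ominus> p \<otimes> q) \<otimes> ?d = p \<otimes> q \<ominus> q"
    using p q pqp pqq
    by (simp add: minus_eq l_distr r_distr l_minus r_minus r_neg l_neg minus_add a_comm)
  have "(?d \<otimes> ?d) \<otimes> ?d = (p \<ominus> p \<otimes> q) \<oplus> (p \<otimes> q \<ominus> q)"
    unfolding dd using p q 1 2 by (simp add: l_distr)
  also have "\<dots> = p \<oplus> ((\<ominus> (p \<otimes> q) \<oplus> p \<otimes> q) \<oplus> \<ominus> q)"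
    using p q by (simp only: minus_eq a_assoc a_closed a_inv_closed m_closed)
  also have "\<dots> = ?d" using p q by (simp add: l_neg minus_eq)
  finally have ddd: "?d \<otimes> ?d \<otimes> ?d = ?d" .
  have d: "?d \<in> carrier R" using p q by simp
  have "(\<one> \<ominus> ?d \<otimes> ?d) \<otimes> ?d = \<zero>"
    using d ddd by (simp add: minus_eq[of \<one>] l_distr l_minus r_neg)
  moreover have "\<one> \<ominus> ?d \<otimes> ?d \<in> Units R"
    using A d by (simp add: numeral_2_eq_2)
  ultimately have "?d = \<zero>"
    using d by (metis Units_closed Units_l_cancel r_null zero_closed)
  then show "p = q" using p q by simp
qed

end

section \<open>Comparison of the seven conditions\<close>

theorem theorem2p3:
  fixes R :: "('a, 'b) ring_scheme" (structure)
    and n :: nat and a b :: 'a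
  assumes "ring R"
    and "n \<ge> 1"
    and "a \<in> carrier R"
    and "pns_drazin_invertible R n a"
    and "b \<in> carrier R"
  shows "let
      inverse_D = pns_drazin_inverse R n;
      idem = pns_idempotent R n;
      sqrtJ = sqrt_jacobson R;
      S1 = (pns_drazin_invertible R n b \<and> idem a = idem b);
      S2 = (idem a \<in> comm2 R b \<and> b [^] n \<ominus> idem a \<in> sqrtJ);
      S3 = (idem a \<in> comm2 R b \<and> b \<otimes> (\<one> \<ominus> idem a) \<in> sqrtJ \<and>
            (\<one> \<ominus> b [^] n) \<otimes> idem a \<in> sqrtJ);
      S4 = (pns_drazin_invertible R n b \<and>
            \<one> \<ominus> idem a \<otimes> (\<one> \<ominus> inverse_D a \<otimes> b) \<in> Units R \<and>
            inverse_D b =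
              inv (\<one> \<ominus> idem a \<otimes> (\<one> \<ominus> inverse_D a \<otimes> b)) \<otimes> inverse_D a);
      S5 = (pns_drazin_invertible R n b \<and>
            inverse_D b \<ominus> inverse_D a = inverse_D a \<otimes> (a \<ominus> b) \<otimes> inverse_D b);
      S6 = (pns_drazin_invertible R n b \<and>
            idem a \<otimes> idem b = idem b \<otimes> idem a \<and>
            \<one> \<ominus> (idem a \<ominus> idem b) [^] (2::nat) \<in> Units R);
      S7 = (pns_drazin_invertible R n b \<and>
            inverse_D b <# carrier R \<subseteq> inverse_D a <# carrier R \<and>
            right_annihilator R (inverse_D b) \<subseteq> right_annihilator R (inverse_D a))
    in (S1 \<longleftrightarrow> S2) \<and> (S1 \<longleftrightarrow> S3) \<and> (S1 \<longleftrightarrow> S4) \<and> (S1 \<longleftrightarrow> S5) \<and> (S1 \<longleftrightarrow> S6) \<and> (S1 \<longleftrightarrow> S7)"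
proof -
  interpret ring R by fact
  define x where "x = pns_drazin_inverse R n a"
  define y where "y = pns_drazin_inverse R n b"
  note n = \<open>n \<ge> 1\<close> and a = \<open>a \<in> carrier R\<close> and b = \<open>b \<in> carrier R\<close>
  have x: "commuting_outer_inverse R a x"
    unfolding x_def using is_pns_drazin_inverse_pns_drazin_inverse[OF n a assms(4)] a
    by (rule commuting_outer_inverse_pns_drazin_inverse)
  \<comment> \<open>\<open>y\<close> stems from a definite description and is only controlled when
    \<open>b\<close> is invertible. \<open>Y\<close> and \<open>S4\<close> to \<open>S7\<close>
    inherit this hypothesis, which conditions (1) and (4) to (7) carry as their first
    conjunct.\<close>
  have y: "commuting_outer_inverse R b y" if "pns_drazin_invertible R n b"
    unfolding y_def using is_pns_drazin_inverse_pns_drazin_inverse[OF n b that] b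
    by (rule commuting_outer_inverse_pns_drazin_inverse)
  have p: "pns_idempotent R n a = a \<otimes> x" and q: "pns_idempotent R n b = b \<otimes> y"
    by (simp_all add: pns_idempotent_def x_def y_def)
  note X = commuting_outer_inverseD[OF x] and Y = commuting_outer_inverseD[OF y]
  have ax: "a \<otimes> x \<in> carrier R" using X(1,2) by simp
  have S12: "pns_drazin_invertible R n b \<and> a \<otimes> x = b \<otimes> y \<longleftrightarrow>
      a \<otimes> x \<in> comm2 R b \<and> b [^] n \<ominus> a \<otimes> x \<in> sqrt_jacobson R"
    using pns_idempotent_eq_iff[OF n b ax X(6)] by (simp only: q)
  \<comment> \<open>Membership in the bicommutant makes \<open>a \<otimes> x\<close> commute with
    \<open>b\<close>, as the Peirce decomposition requires.\<close>
  have S23: "a \<otimes> x \<in> comm2 R b \<and> b [^] n \<ominus> a \<otimes> x \<in> sqrt_jacobson R \<longleftrightarrow>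
      a \<otimes> x \<in> comm2 R b \<and> b \<otimes> (\<one> \<ominus> a \<otimes> x) \<in> sqrt_jacobson R \<and>
      (\<one> \<ominus> b [^] n) \<otimes> (a \<otimes> x) \<in> sqrt_jacobson R"
    using pow_minus_idempotent_sqrt_jacobson_iff[OF n b ax X(6)]
      comm2_commute[of "a \<otimes> x" b b] b by auto
  note S4 = outer_inverse_idempotents_eq_iff_Unit[OF x y]
  note S5 = outer_inverse_idempotents_eq_iff_diff[OF x y]
  note S6 = commuting_idempotents_eq_iff[OF ax X(6) m_closed[OF Y(1,2)] Y(6)]
  note S7 = outer_inverse_idempotents_eq_iff_subset[OF x y]
  show ?thesis
    unfolding Let_def p q x_def[symmetric] y_def[symmetric]
    using S12 S23 S4 S5 S6 S7 by blast
qed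

end
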